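(* Let $X_1,X_2,\dots$ be i.i.d. real random variables whose common distribution $F$ is symmetric, and let $S_n=X_1+\cdots+X_n$ for $n\ge 1$. Then for any increasing sequence $(g_n)_{n\ge1}$ of positive numbers and any $M>0$: (i) if $\sum_{n=1}^{+\infty}\mathbb{P}(g_n|S_n|<M)=+\infty$, then $\liminf_{n\to+\infty} g_n|S_n|=0$ almost surely; (ii) otherwise, $\liminf_{n\to+\infty} g_n|S_n|=+\infty$ almost surely.
   Context: A distribution $F$ on $\mathbb{R}$ is symmetric if it is the distribution of a symmetric random variable, i.e. of a random variable $X$ such that $X$ and $-X$ have the same law. "Increasing" means nondecreasing (constant sequences are allowed). *)

theory Defs
  imports "HOL-Probability.Probability"
begin

definition symmetric_rv :: "'a measure \<Rightarrow> ('a \<Rightarrow> real) \<Rightarrow> bool" where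
  "symmetric_rv P Y \<longleftrightarrow> Y \<in> borel_measurable P \<and>
     distr P borel Y = distr P borel (\<lambda>\<omega>. - Y \<omega>)"

(* HOL cannot quantify over the type of the sample space inside a definition. Fixing it to be
   real loses nothing: a law F of a symmetric variable on any probability space is also the law
   of the identity on (R, F), which is again symmetric. *)
definition symmetric_distribution :: "real measure \<Rightarrow> bool" where
  "symmetric_distribution F \<longleftrightarrow>
     (\<exists>(Q :: real measure) Y. prob_space Q \<and> symmetric_rv Q Y \<and> F = distr Q borel Y)"

(* The steps are X 1, X 2, ...; the value X 0 is never used. *)
definition partial_sum :: "(nat \<Rightarrow> 'a \<Rightarrow> real) \<Rightarrow> nat \<Rightarrow> 'a \<Rightarrow> real" where
  "partial_sum X n \<omega> = (\<Sum>i=1..n. X i \<omega>)"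

end

theory Submission
  imports Defs
begin

text \<open>
  Write $S_{2n}$ as a difference $U - V$ of independent variables with the law of $S_n$, which
  symmetry allows. Cutting the line into cells of length $e$ and using $2ab \le a^2 + b^2$, no
  difference of cell indices of $U$ and $V$ is more likely than $0$, so every interval of length
  of order $Ke$ has $S_{2n}$-probability at most $(2K+2) P(|S_{2n}| < e)$. Consequently the
  divergence of the series depends neither on $M$ nor on the odd terms, and (ii) is Borel-Cantelli.
  For (i), the same bound together with the monotonicity of $g$ yields
  $P(A_m \cap A_n) \le 4 P(A_m) P(A_{n-m})$ for $A_n = \{g_{2n} |S_{2n}| < e\}$, and a
  Kochen-Stone argument shows that infinitely many $A_n$ occur with positive probability. This
  event is exchangeable, so by the Hewitt-Savage zero-one law its probability is $1$.
\<close>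

section \<open>Concentration of a difference of i.i.d. variables\<close>

text \<open>By independence of the coordinates, the two sides are the sums over \<open>k\<close> of
  \<open>p k * p (k - j)\<close> and of \<open>p k * p k\<close>, with \<open>p\<close> the law of
  \<open>f\<close>. AM-GM bounds the first by half of two sums of squares, which coincide because
  translation by \<open>j\<close> permutes the integers.\<close>

lemma (in prob_space) pair_measure_diff_eq_le:
  fixes f :: "'a \<Rightarrow> int"
  assumes [measurable]: "f \<in> measurable M (count_space UNIV)"
  shows "emeasure (M \<Otimes>\<^sub>M M) {x \<in> space (M \<Otimes>\<^sub>M M). f (fst x) - f (snd x) = j}
    \<le> emeasure (M \<Otimes>\<^sub>M M) {x \<in> space (M \<Otimes>\<^sub>M M). f (fst x) = f (snd x)}"
proof -
  have [measurable]: "{x \<in> space M. f x = k} \<in> sets M" for k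
    by measurable
  define p where "p k = emeasure M {x \<in> space M. f x = k}" for k
  have split: "emeasure (M \<Otimes>\<^sub>M M) {x \<in> space (M \<Otimes>\<^sub>M M). f (fst x) - f (snd x) = i}
    = (\<integral>\<^sup>+k. p k * p (k - i) \<partial>count_space UNIV)" for i
  proof -
    have "{x \<in> space (M \<Otimes>\<^sub>M M). f (fst x) - f (snd x) = i}
      = (\<Union>k\<in>UNIV. {x \<in> space M. f x = k} \<times> {x \<in> space M. f x = k - i})"
      by (auto simp: space_pair_measure)
    moreover have "emeasure (M \<Otimes>\<^sub>M M) \<dots> = (\<integral>\<^sup>+k. emeasure (M \<Otimes>\<^sub>M M)
        ({x \<in> space M. f x = k} \<times> {x \<in> space M. f x = k - i}) \<partial>count_space UNIV)"
      by (intro emeasure_UN_countable) (auto simp: disjoint_family_on_def)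
    moreover have "emeasure (M \<Otimes>\<^sub>M M) ({x \<in> space M. f x = k} \<times> {x \<in> space M. f x = k - i}) = p k * p (k - i)" for k
      unfolding p_def by (rule emeasure_pair_measure_Times) simp_all
    ultimately show ?thesis by simp
  qed
  have shift: "(\<integral>\<^sup>+k. p (k - j) * p (k - j) \<partial>count_space UNIV) = (\<integral>\<^sup>+k. p k * p k \<partial>count_space UNIV)"
    using nn_integral_bij_count_space[of "\<lambda>k. k - j" UNIV UNIV "\<lambda>k. p k * p k"]
    by (simp add: bij_diff_right bij_diff)
  have amgm: "2 * (p k * p l) \<le> p k * p k + p l * p l" for k l
  proof -
    \<comment> \<open>The bound rests on a square being nonnegative, so it is proved for real
      numbers and then carried over to \<open>ennreal\<close>.\<close>
    define a b where "a = measure M {x \<in> space M. f x = k}" and "b = measure M {x \<in> space M. f x = l}"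
    have "p k = ennreal a" "p l = ennreal b" "a \<ge> 0" "b \<ge> 0"
      by (simp_all add: p_def a_def b_def emeasure_eq_measure)
    moreover have "2 * (a * b) \<le> a * a + b * b"
      using sum_squares_bound[of a b] by (simp add: power2_eq_square)
    ultimately show ?thesis
      by (simp flip: ennreal_mult ennreal_plus ennreal_numeral)
  qed
  have "2 * (\<integral>\<^sup>+k. p k * p (k - j) \<partial>count_space UNIV)
      \<le> (\<integral>\<^sup>+k. p k * p k + p (k - j) * p (k - j) \<partial>count_space UNIV)"
    by (subst nn_integral_cmult[symmetric]) (auto intro!: nn_integral_mono amgm)
  also have "\<dots> = 2 * (\<integral>\<^sup>+k. p k * p k \<partial>count_space UNIV)"
    by (simp add: nn_integral_add shift mult_2)
  finally have "(\<integral>\<^sup>+k. p k * p (k - j) \<partial>count_space UNIV) \<le> (\<integral>\<^sup>+k. p k * p k \<partial>count_space UNIV)"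
    by (simp add: ennreal_mult_le_mult_iff)
  with split[of j] split[of 0] show ?thesis by simp
qed

text \<open>The centre \<open>-y\<close> of the large interval is arbitrary while the small one sits
  at 0. This uniformity is what later permits conditioning on an independent summand.\<close>

lemma concentration_difference:
  fixes \<mu> :: "real measure" and y e :: real and K :: nat
  assumes "prob_space \<mu>" and [measurable_cong]: "sets \<mu> = sets borel" and e: "e > 0"
  shows "measure (\<mu> \<Otimes>\<^sub>M \<mu>) {x. \<bar>fst x - snd x + y\<bar> < real K * e}
    \<le> (2 * real K + 2) * measure (\<mu> \<Otimes>\<^sub>M \<mu>) {x. \<bar>fst x - snd x\<bar> < e}"
proof -
  interpret prob_space \<mu> by fact
  interpret pair_prob_space \<mu> \<mu> ..
  let ?N = "\<mu> \<Otimes>\<^sub>M \<mu>"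
  have sp[simp]: "space ?N = UNIV"
    using sets_eq_imp_space_eq[OF assms(2)] by (simp add: space_pair_measure)
  define c :: "real \<Rightarrow> int" where "c u = \<lfloor>u / e\<rfloor>" for u
  have [measurable]: "c \<in> measurable \<mu> (count_space UNIV)"
    unfolding c_def by measurable
  define a where "a = \<lfloor>- y / e\<rfloor>"
  \<comment> \<open>When \<open>fst x - snd x\<close> is within \<open>K * e\<close> of
    \<open>-y\<close>, the two floors shift the difference of cell indices by less than 1 either
    way, and \<open>a\<close> rounds \<open>-y / e\<close> down by less than 1. The integers left
    are exactly these \<open>2 * K + 2\<close>.\<close>
  define J where "J = {a - int K .. a + int K + 1}"
  have cle: "u - e < c u * e \<and> c u * e \<le> u" for u
  proof -
    have "u / e - 1 < c u \<and> c u \<le> u / e" unfolding c_def by linarith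
    then show ?thesis using e by (auto simp: field_simps)
  qed
  have sub: "{x. \<bar>fst x - snd x + y\<bar> < real K * e} \<subseteq> (\<Union>j\<in>J. {x. c (fst x) - c (snd x) = j})"
  proof
    fix x :: "real \<times> real" assume "x \<in> {x. \<bar>fst x - snd x + y\<bar> < real K * e}"
    then have h: "\<bar>(fst x - snd x + y) / e\<bar> < real K"
      using e by (simp add: abs_divide divide_less_eq)
    have eq: "(fst x - snd x + y) / e = fst x / e - snd x / e - (- y / e)"
      by (simp add: diff_divide_distrib add_divide_distrib)
    have fl: "u / e - 1 < real_of_int (c u)" "real_of_int (c u) \<le> u / e" for u
      unfolding c_def by linarith+
    have fa: "real_of_int a \<le> - y / e" "- y / e < real_of_int a + 1"
      unfolding a_def by linarith+
    have "real_of_int (a - int K - 1) < real_of_int (c (fst x) - c (snd x))"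
      using h fl(1)[of "fst x"] fl(2)[of "snd x"] fa unfolding eq
        of_int_diff of_int_of_nat_eq of_int_1 by linarith
    moreover have "real_of_int (c (fst x) - c (snd x)) < real_of_int (a + int K + 2)"
      using h fl(2)[of "fst x"] fl(1)[of "snd x"] fa unfolding eq
        of_int_diff of_int_add of_int_of_nat_eq of_int_numeral by linarith
    ultimately have "c (fst x) - c (snd x) \<in> J"
      unfolding J_def of_int_less_iff by simp
    then show "x \<in> (\<Union>j\<in>J. {x. c (fst x) - c (snd x) = j})" by auto
  qed
  have diag: "measure ?N {x. c (fst x) - c (snd x) = j} \<le> measure ?N {x. c (fst x) = c (snd x)}" for j
    using prob_space.pair_measure_diff_eq_le[OF assms(1), of c j] by (simp add: P.emeasure_eq_measure)
  have [measurable]: "{x. c (fst x) - c (snd x) = j} \<in> sets ?N" for j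
    using measurable_sets[of "\<lambda>x. c (fst x) - c (snd x)" ?N "count_space UNIV" "{j}"] by (simp add: vimage_def)
  have "measure ?N {x. \<bar>fst x - snd x + y\<bar> < real K * e}
      \<le> measure ?N (\<Union>j\<in>J. {x. c (fst x) - c (snd x) = j})"
    by (intro P.finite_measure_mono[OF sub]) (auto simp: J_def)
  also have "\<dots> \<le> (\<Sum>j\<in>J. measure ?N {x. c (fst x) - c (snd x) = j})"
    by (intro P.finite_measure_subadditive_finite) (auto simp: J_def)
  also have "\<dots> \<le> (\<Sum>j\<in>J. measure ?N {x. c (fst x) = c (snd x)})"
    by (intro sum_mono diag)
  also have "\<dots> = (2 * real K + 2) * measure ?N {x. c (fst x) = c (snd x)}"
    by (simp add: J_def)
  \<comment> \<open>Two points of the same half-open cell of length \<open>e\<close> differ by less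
    than \<open>e\<close>.\<close>
  also have "\<dots> \<le> (2 * real K + 2) * measure ?N {x. \<bar>fst x - snd x\<bar> < e}"
  proof (intro mult_left_mono P.finite_measure_mono subsetI)
    fix x :: "real \<times> real" assume "x \<in> {x. c (fst x) = c (snd x)}"
    then show "x \<in> {x. \<bar>fst x - snd x\<bar> < e}" using cle[of "fst x"] cle[of "snd x"] by auto
  next
    have "(\<lambda>x. \<bar>fst x - snd x\<bar>) \<in> borel_measurable ?N" by measurable
    then show "{x. \<bar>fst x - snd x\<bar> < e} \<in> P.events"
      by (simp add: borel_measurable_iff_less)
  qed simp
  finally show ?thesis .
qed

section \<open>The Hewitt-Savage zero-one law\<close>

lemma has_bochner_integral_nonneg:
  fixes f :: "'a \<Rightarrow> real"
  assumes "has_bochner_integral M f x" "\<And>y. 0 \<le> f y"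
  shows "0 \<le> x"
  using has_bochner_integral_integral_eq[OF assms(1)] assms(2) Bochner_Integration.integral_nonneg[of M f]
  by simp

text \<open>Copy the cylinder onto infinitely many disjoint blocks of coordinates. The copies are
  independent, and since \<open>H\<close> is invariant under swapping two blocks, all have the same
  covariance with \<open>H\<close>. A bounded variable cannot have the same nonzero covariance with
  infinitely many orthogonal bounded ones.\<close>

lemma PiM_indep_of_finite_coordinates:
  fixes F :: "'a measure"
  defines "N \<equiv> PiM UNIV (\<lambda>_::nat. F)"
  assumes F: "prob_space F" and H[measurable]: "H \<in> sets N"
    and inv: "\<And>\<pi> y. bij \<pi> \<Longrightarrow> finite {i. \<pi> i \<noteq> i} \<Longrightarrow> y \<in> H \<Longrightarrow> y \<circ> \<pi> \<in> H"
    and J: "finite J" and C: "\<And>n. n \<in> J \<Longrightarrow> C n \<in> sets F"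
  shows "measure N (H \<inter> {y \<in> space N. \<forall>n\<in>J. y n \<in> C n})
    = measure N H * measure N {y \<in> space N. \<forall>n\<in>J. y n \<in> C n}"
proof -
  interpret F: prob_space F by fact
  interpret Q: product_prob_space "\<lambda>_::nat. F" UNIV ..
  interpret N: prob_space N unfolding N_def by (rule prob_space_PiM) (rule F)
  have spN: "space N = {y. \<forall>n. y n \<in> space F}"
    by (auto simp: N_def space_PiM PiE_def)
  have cyl: "measure N {y \<in> space N. \<forall>n\<in>A. y n \<in> D n} = (\<Prod>n\<in>A. measure F (D n))"
      "{y \<in> space N. \<forall>n\<in>A. y n \<in> D n} \<in> sets N"
    if "finite A" "\<And>n. n \<in> A \<Longrightarrow> D n \<in> sets F" for A :: "nat set" and D
  proof -
    have [measurable]: "(\<lambda>y. y n) \<in> measurable N F" for n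
      unfolding N_def by measurable
    have eq: "{y \<in> space N. \<forall>n\<in>A. y n \<in> D n} = Q.emb UNIV A (Pi\<^sub>E A D)"
      using that(2)[THEN sets.sets_into_space] by (auto simp: prod_emb_def spN PiE_def Pi_def)
    show "measure N {y \<in> space N. \<forall>n\<in>A. y n \<in> D n} = (\<Prod>n\<in>A. measure F (D n))"
      unfolding eq unfolding N_def by (rule Q.measure_PiM_emb) (use that in auto)
    show "{y \<in> space N. \<forall>n\<in>A. y n \<in> D n} \<in> sets N"
      unfolding eq unfolding N_def by (rule sets_PiM_I) (use that in auto)
  qed
  obtain k where k: "\<And>n. n \<in> J \<Longrightarrow> n < k"
    using J by (metis finite_nat_bounded lessThan_iff subset_iff)
  \<comment> \<open>As \<open>k\<close> exceeds every element of \<open>J\<close>, the translates of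
    \<open>J\<close> by multiples of \<open>k\<close> are disjoint, and \<open>m mod k\<close>
    recovers the original coordinate from a translated one.\<close>
  define sh where "sh j n = n + j * k" for j n :: nat
  define B where "B j = {y \<in> space N. \<forall>n\<in>J. y (sh j n) \<in> C n}" for j
  define p where "p = (\<Prod>n\<in>J. measure F (C n))"
  have B_cyl: "B j = {y \<in> space N. \<forall>m\<in>sh j ` J. y m \<in> C (m mod k)}" for j
    using k by (auto simp: B_def sh_def)
  have C': "C (m mod k) \<in> sets F" if "m \<in> sh j ` J" for m j
    using that k C by (auto simp: sh_def)
  have [measurable]: "B j \<in> sets N" for j
    unfolding B_cyl by (rule cyl) (use J C' in auto)
  have prod_sh: "(\<Prod>m\<in>sh j ` J. measure F (C (m mod k))) = p" for j
    unfolding p_def by (subst prod.reindex) (use k in \<open>auto simp: sh_def inj_on_def intro!: prod.cong\<close>)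
  have mB: "measure N (B j) = p" for j
    unfolding B_cyl by (subst cyl) (use J C' in \<open>auto simp: prod_sh\<close>)
  have mBB: "measure N (B i \<inter> B j) = p * p" if "i \<noteq> j" for i j
  proof -
    have disj: "sh i ` J \<inter> sh j ` J = {}"
    proof (safe)
      fix n m assume "n \<in> J" "m \<in> J" "sh i n = sh j m"
      then have "(n + i * k) div k = (m + j * k) div k" "n < k" "m < k"
        using k by (auto simp: sh_def)
      with that show "sh i n \<in> {}" by simp
    qed
    have "B i \<inter> B j = {y \<in> space N. \<forall>m\<in>sh i ` J \<union> sh j ` J. y m \<in> C (m mod k)}"
      unfolding B_cyl by auto
    also have "measure N \<dots> = (\<Prod>m\<in>sh i ` J \<union> sh j ` J. measure F (C (m mod k)))"
      by (rule cyl) (use J C' in auto)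
    also have "\<dots> = p * p"
      using J by (subst prod.union_disjoint) (auto simp: disj prod_sh)
    finally show ?thesis .
  qed
  have mHB: "measure N (H \<inter> B j) = measure N (H \<inter> B 0)" for j
  proof -
    define m where "m = j * k"
    \<comment> \<open>\<open>\<pi>\<close> exchanges the block of the first \<open>k\<close>
      coordinates with the block of length \<open>k\<close> starting at \<open>m\<close>. The blocks
      are disjoint, or equal when \<open>j = 0\<close>, so \<open>\<pi>\<close> is an
      involution.\<close>
    define \<pi> where "\<pi> n = (if n < k then n + m else if m \<le> n \<and> n < m + k then n - m else n)" for n
    have "m = 0 \<or> k \<le> m" by (cases j) (auto simp: m_def)
    then have \<pi>\<pi>: "\<pi> (\<pi> n) = n" for n unfolding \<pi>_def by auto
    then have "bij \<pi>" by (rule involuntory_imp_bij)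
    have "{i. \<pi> i \<noteq> i} \<subseteq> {..<m + k}" by (auto simp: \<pi>_def)
    then have fin: "finite {i. \<pi> i \<noteq> i}" by (rule finite_subset) simp
    have sp: "y \<circ> \<pi> \<in> space N" if "y \<in> space N" for y using that by (auto simp: spN)
    have [measurable]: "(\<lambda>y. y \<circ> \<pi>) \<in> measurable N N"
      unfolding N_def comp_def by (rule measurable_PiM_single') (auto simp: space_PiM)
    have "distr N N (\<lambda>y. y \<circ> \<pi>) = N"
      using distr_PiM_reindex[of UNIV "\<lambda>_. F" \<pi> UNIV] bij_is_inj[OF \<open>bij \<pi>\<close>] F
      by (simp add: N_def comp_def restrict_def)
    then have "measure N (H \<inter> B 0) = measure (distr N N (\<lambda>y. y \<circ> \<pi>)) (H \<inter> B 0)" by simp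
    also have "\<dots> = measure N ((\<lambda>y. y \<circ> \<pi>) -` (H \<inter> B 0) \<inter> space N)"
      by (rule measure_distr) auto
    also have "(\<lambda>y. y \<circ> \<pi>) -` (H \<inter> B 0) \<inter> space N = H \<inter> B j"
    proof -
      \<comment> \<open>The converse direction comes from invariance applied to
        \<open>y \<circ> \<pi>\<close>, as \<open>\<pi>\<close> is its own inverse.\<close>
      have "y \<circ> \<pi> \<in> H \<longleftrightarrow> y \<in> H" for y
        using inv[OF \<open>bij \<pi>\<close> fin, of y] inv[OF \<open>bij \<pi>\<close> fin, of "y \<circ> \<pi>"] by (auto simp: o_assoc[symmetric] comp_def \<pi>\<pi>)
      moreover have "y \<circ> \<pi> \<in> B 0 \<longleftrightarrow> y \<in> B j" if "y \<in> space N" for y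
        using that sp k by (auto simp: B_def sh_def \<pi>_def m_def)
      moreover have "H \<subseteq> space N" using sets.sets_into_space[OF H] .
      ultimately show ?thesis by auto
    qed
    finally show ?thesis by simp
  qed
  \<comment> \<open>\<open>d\<close> is the covariance of \<open>H\<close> with the cylinder, so the
    claim is \<open>d = 0\<close>.\<close>
  define d where "d = measure N (H \<inter> B 0) - measure N H * p"
  define h where "h = (indicator H :: _ \<Rightarrow> real)"
  define f where "f j y = indicator (B j) y - p" for j y
  have hf: "has_bochner_integral N (\<lambda>y. h y * f j y) d" for j
  proof -
    have "has_bochner_integral N (\<lambda>y. indicator (H \<inter> B j) y - p * indicator H y) (measure N (H \<inter> B j) - p * measure N H)"
      by (intro has_bochner_integral_diff has_bochner_integral_mult_right has_bochner_integral_real_indicator)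
        (auto simp: N.emeasure_eq_measure)
    then show ?thesis
      by (simp add: h_def f_def d_def mHB[of j] indicator_inter_arith algebra_simps)
  qed
  have ff: "has_bochner_integral N (\<lambda>y. f i y * f j y) (if i = j then p - p * p else 0)" for i j
  proof -
    have "has_bochner_integral N (\<lambda>y. indicator (B i \<inter> B j) y - p * indicator (B i) y - p * indicator (B j) y + p * p * indicator (space N) y)
      (measure N (B i \<inter> B j) - p * measure N (B i) - p * measure N (B j) + p * p * measure N (space N))"
      by (intro has_bochner_integral_diff has_bochner_integral_add has_bochner_integral_mult_right has_bochner_integral_real_indicator)
        (auto simp: N.emeasure_eq_measure)
    moreover have "measure N (B i \<inter> B j) - p * measure N (B i) - p * measure N (B j) + p * p * measure N (space N)
        = (if i = j then p - p * p else 0)"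
      by (simp add: mB mBB N.prob_space)
    ultimately show ?thesis
      by (rule_tac has_bochner_integral_cong[THEN iffD1, rotated -1])
        (auto simp: f_def indicator_inter_arith algebra_simps)
  qed
  have hh: "has_bochner_integral N (\<lambda>y. h y * h y) (measure N H)"
    using has_bochner_integral_real_indicator[of H N] by (simp add: N.emeasure_eq_measure h_def indicator_inter_arith[symmetric])
  \<comment> \<open>Bessel's inequality: the \<open>f j\<close> are orthogonal, and \<open>h\<close> has the same inner product \<open>d\<close> with each.\<close>
  have "real n * d\<^sup>2 \<le> 1" for n
  proof -
    have big: "has_bochner_integral N
        (\<lambda>y. h y * h y - 2 * d * (\<Sum>j<n. h y * f j y) + d\<^sup>2 * (\<Sum>i<n. \<Sum>j<n. f i y * f j y))
        (measure N H - 2 * d * (\<Sum>j<n. d) + d\<^sup>2 * (\<Sum>i<n. \<Sum>j<n. if i = j then p - p * p else 0))"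
      by (intro has_bochner_integral_diff has_bochner_integral_add has_bochner_integral_mult_right
        has_bochner_integral_sum hh hf ff)
    have square: "h y * h y - 2 * d * (\<Sum>j<n. h y * f j y) + d\<^sup>2 * (\<Sum>i<n. \<Sum>j<n. f i y * f j y)
        = (h y - d * (\<Sum>j<n. f j y))\<^sup>2" for y
      by (simp add: power2_diff power_mult_distrib power2_eq_square[of "\<Sum>j<n. f j y"] sum_product
        sum_distrib_left[symmetric] power2_eq_square[of "h y"])
    have "0 \<le> measure N H - 2 * d * (\<Sum>j<n. d) + d\<^sup>2 * (\<Sum>i<n. \<Sum>j<n. if i = j then p - p * p else 0)"
      by (rule has_bochner_integral_nonneg[OF big[unfolded square]]) simp
    then have "0 \<le> measure N H - 2 * real n * d\<^sup>2 + d\<^sup>2 * (real n * (p - p * p))"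
      by (simp add: power2_eq_square algebra_simps)
    \<comment> \<open>Bounding the variance by 1 leaves
      \<open>-2 * n * d\<^sup>2 + n * d\<^sup>2\<close> next to \<open>measure N H\<close>, which is
      at most 1.\<close>
    moreover have "p - p * p \<le> 1"
      using mB[of 0] measure_nonneg[of N "B 0"] N.prob_le_1[of "B 0"] by (smt (verit) mult_nonneg_nonneg)
    then have "d\<^sup>2 * (real n * (p - p * p)) \<le> d\<^sup>2 * (real n * 1)"
      by (intro mult_left_mono) auto
    ultimately show ?thesis
      using N.prob_le_1[of H] by argo
  qed
  then have "d\<^sup>2 \<le> 0"
    by (metis not_le reals_Archimedean3)
  then have "d = 0" by simp
  moreover have "B 0 = {y \<in> space N. \<forall>n\<in>J. y n \<in> C n}" by (simp add: B_def sh_def)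
  ultimately show ?thesis using mB[of 0] by (simp add: d_def)
qed

text \<open>By the preceding lemma, \<open>N\<close> restricted to \<open>H\<close> and
  \<open>N\<close> scaled by the mass of \<open>H\<close> agree on cylinders, hence everywhere.
  Evaluating both at \<open>H\<close> itself shows that the mass of \<open>H\<close> equals its
  square.\<close>

theorem hewitt_savage_zero_one:
  fixes F :: "'a measure"
  defines "N \<equiv> PiM UNIV (\<lambda>_::nat. F)"
  assumes F: "prob_space F" and H[measurable]: "H \<in> sets N"
    and inv: "\<And>\<pi> y. bij \<pi> \<Longrightarrow> finite {i. \<pi> i \<noteq> i} \<Longrightarrow> y \<in> H \<Longrightarrow> y \<circ> \<pi> \<in> H"
  shows "measure N H = 0 \<or> measure N H = 1"
proof -
  interpret F: prob_space F by fact
  interpret Q: product_prob_space "\<lambda>_::nat. F" UNIV ..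
  interpret N: prob_space N unfolding N_def by (rule prob_space_PiM) (rule F)
  have "density N (indicator H) = scale_measure (emeasure N H) N"
  proof (rule measure_eqI_PiM_infinite)
    fix A :: "nat \<Rightarrow> 'a set" and J :: "nat set"
    assume A: "finite J" "\<And>i. i \<in> J \<Longrightarrow> A i \<in> sets F"
    let ?B = "{y \<in> space N. \<forall>n\<in>J. y n \<in> A n}"
    have eq: "Q.emb UNIV J (Pi\<^sub>E J A) = ?B"
      using A(2)[THEN sets.sets_into_space] by (auto simp: N_def prod_emb_def space_PiM PiE_def Pi_def)
    have [measurable]: "?B \<in> sets N"
      unfolding eq[symmetric] unfolding N_def by (rule sets_PiM_I) (use A in auto)
    have "measure N (H \<inter> ?B) = measure N H * measure N ?B"
      using PiM_indep_of_finite_coordinates[OF F, of H J A] H inv A by (auto simp: N_def)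
    then have "emeasure N (H \<inter> ?B) = emeasure N H * emeasure N ?B"
      by (simp add: N.emeasure_eq_measure ennreal_mult)
    then show "emeasure (density N (indicator H)) (Q.emb UNIV J (Pi\<^sub>E J A))
        = emeasure (scale_measure (emeasure N H) N) (Q.emb UNIV J (Pi\<^sub>E J A))"
      unfolding eq by (subst emeasure_density) (auto simp: indicator_inter_arith[symmetric])
  next
    show "finite_measure (density N (indicator H))"
      by (intro finite_measureI) (simp add: emeasure_density nn_integral_indicator)
  qed (simp_all add: N_def)
  then have "emeasure (density N (indicator H)) H = emeasure N H * emeasure N H"
    by simp
  then have "measure N H = measure N H * measure N H"
    by (simp add: emeasure_density indicator_inter_arith[symmetric] N.emeasure_eq_measure ennreal_mult[symmetric])
  then show ?thesis by auto
qed

section \<open>A Kochen-Stone lemma\<close>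

text \<open>The renewal bound stands in for independence in the second Borel-Cantelli lemma: it
  controls the second moment of the number of events by the square of the first. Every tail union
  then has probability at least \<open>1 / (2 * C)\<close>, and so does their decreasing
  limit.\<close>

lemma (in prob_space) kochen_stone_renewal:
  fixes A :: "nat \<Rightarrow> 'a set" and C :: real
  assumes A[measurable]: "\<And>n. A n \<in> events" and C: "C > 0"
    and renewal: "\<And>m n. m < n \<Longrightarrow> prob (A m \<inter> A n) \<le> C * prob (A m) * prob (A (n - m))"
    and div: "\<not> summable (\<lambda>n. prob (A n))"
  shows "prob {\<omega> \<in> space M. \<exists>\<^sub>\<infinity>n. \<omega> \<in> A n} > 0"
proof -
  define p where "p n = prob (A n)" for n
  have p: "0 \<le> p n" "p n \<le> 1" for n by (simp_all add: p_def)
  define D where "D K = (\<Union>n\<in>{K..}. A n)" for K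
  have [measurable]: "D K \<in> events" for K unfolding D_def by measurable
  have D_ge: "1 / (2 * C) \<le> prob (D K)" for K
  proof (rule ccontr)
    define q where "q = prob (D K)"
    assume "\<not> 1 / (2 * C) \<le> prob (D K)"
    then have q: "2 * C * q < 1" using C by (simp add: q_def field_simps)
    \<comment> \<open>This is the value of \<open>s\<close> at which the linear factor in the final
      second-moment inequality vanishes. The assumption on \<open>q\<close> makes the denominator
      positive.\<close>
    define b where "b = (1 + 2 * C * K) / (2 * C * (1 - 2 * C * q))"
    have tail: "sum p {K..<N} \<le> b" if "K \<le> N" for N
    proof -
      define I where "I = {K..<N}"
      have [simp]: "finite I" by (simp add: I_def)
      define s where "s = sum p I"
      have s0: "s \<ge> 0" unfolding s_def by (intro sum_nonneg) (simp add: p)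
      \<comment> \<open>Differences of indices in \<open>I\<close> may fall below \<open>K\<close>,
        outside \<open>I\<close>; these at most \<open>K\<close> terms are each bounded by
        1.\<close>
      have t: "sum p {..<N} \<le> s + K"
      proof -
        have "sum p {..<N} = sum p {..<K} + s"
          unfolding s_def I_def using that
          by (subst sum.union_disjoint[symmetric]) (auto intro!: sum.cong)
        also have "sum p {..<K} \<le> K" using sum_mono[of "{..<K}" p "\<lambda>_. 1"] p by simp
        finally show ?thesis by simp
      qed
      \<comment> \<open>\<open>g\<close> bounds the pairs above the diagonal. For fixed
        \<open>m\<close> the differences \<open>n - m\<close> are distinct and below
        \<open>N\<close>, so the inner sum of \<open>p (n - m)\<close> is at most
        \<open>s + K\<close>.\<close>
      define g where "g m n = (if m < n then C * p m * p (n - m) else 0)" for m n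
      have g: "(\<Sum>m\<in>I. \<Sum>n\<in>I. g m n) \<le> C * s * (s + K)"
      proof -
        have "(\<Sum>n\<in>I. g m n) \<le> C * p m * (s + K)" if "m \<in> I" for m
        proof -
          have "(\<Sum>n\<in>I. g m n) = (\<Sum>n\<in>{n\<in>I. m < n}. C * p m * p (n - m))"
            unfolding g_def by (simp add: sum.inter_filter)
          also have "\<dots> = C * p m * (\<Sum>n\<in>{n\<in>I. m < n}. p (n - m))"
            by (simp add: sum_distrib_left)
          also have "(\<Sum>n\<in>{n\<in>I. m < n}. p (n - m)) = sum p ((\<lambda>n. n - m) ` {n\<in>I. m < n})"
            by (subst sum.reindex) (auto simp: inj_on_def)
          also have "\<dots> \<le> sum p {..<N}"
            by (rule sum_mono2) (auto simp: I_def p)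
          finally show ?thesis using t p[of m] C
            by (meson mult_left_mono order_trans mult_nonneg_nonneg less_imp_le)
        qed
        then have "(\<Sum>m\<in>I. \<Sum>n\<in>I. g m n) \<le> (\<Sum>m\<in>I. C * p m * (s + K))" by (rule sum_mono)
        also have "\<dots> = C * s * (s + K)" by (simp add: s_def sum_distrib_left sum_distrib_right)
        finally show ?thesis .
      qed
      have AA: "prob (A m \<inter> A n) \<le> g m n + g n m + (if m = n then p m else 0)" for m n
        using renewal[of m n] renewal[of n m] by (auto simp: g_def p_def Int_commute not_less_iff_gr_or_eq)
      have "(\<Sum>m\<in>I. \<Sum>n\<in>I. prob (A m \<inter> A n))
          \<le> (\<Sum>m\<in>I. \<Sum>n\<in>I. g m n + g n m + (if m = n then p m else 0))"
        by (intro sum_mono AA)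
      also have "\<dots> = (\<Sum>m\<in>I. \<Sum>n\<in>I. g m n) + (\<Sum>m\<in>I. \<Sum>n\<in>I. g n m) + s"
        by (simp add: sum.distrib s_def)
      also have "(\<Sum>m\<in>I. \<Sum>n\<in>I. g n m) = (\<Sum>m\<in>I. \<Sum>n\<in>I. g m n)" by (rule sum.swap)
      finally have second: "(\<Sum>m\<in>I. \<Sum>n\<in>I. prob (A m \<inter> A n)) \<le> 2 * C * s * (s + K) + s"
        using g by simp
      \<comment> \<open>Take expectations in \<open>(Z - t * indicator (D K))\<^sup>2 \<ge> 0\<close>, where \<open>Z\<close> counts the events
        indexed by \<open>I\<close> and vanishes off \<open>D K\<close>; this \<open>t\<close> makes the \<open>s\<^sup>2\<close>-coefficient negative.\<close>
      define t where "t = 2 * C * s"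
      have "has_bochner_integral M
          (\<lambda>\<omega>. (\<Sum>m\<in>I. \<Sum>n\<in>I. indicator (A m \<inter> A n) \<omega>) - 2 * t * (\<Sum>n\<in>I. indicator (A n) \<omega>)
            + t\<^sup>2 * indicator (D K) \<omega>)
          ((\<Sum>m\<in>I. \<Sum>n\<in>I. prob (A m \<inter> A n)) - 2 * t * (\<Sum>n\<in>I. p n) + t\<^sup>2 * q)"
        unfolding p_def q_def
        by (intro has_bochner_integral_diff has_bochner_integral_add has_bochner_integral_mult_right
            has_bochner_integral_sum has_bochner_integral_real_indicator) (auto simp: emeasure_eq_measure)
      moreover have "0 \<le> (\<Sum>m\<in>I. \<Sum>n\<in>I. indicator (A m \<inter> A n) \<omega>) - 2 * t * (\<Sum>n\<in>I. indicator (A n) \<omega>)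
            + t\<^sup>2 * (indicator (D K) \<omega> :: real)" for \<omega>
      proof -
        let ?Z = "\<Sum>n\<in>I. indicator (A n) \<omega> :: real"
        have "(\<Sum>m\<in>I. \<Sum>n\<in>I. indicator (A m \<inter> A n) \<omega>) = ?Z * ?Z"
          by (simp add: sum_product indicator_inter_arith)
        moreover have "?Z = 0" if "\<omega> \<notin> D K"
          using that by (intro sum.neutral) (auto simp: D_def I_def)
        moreover have "0 \<le> (?Z - t)\<^sup>2" by simp
        ultimately show ?thesis
          by (cases "\<omega> \<in> D K") (auto simp: power2_diff power2_eq_square[of ?Z] algebra_simps)
      qed
      ultimately have "0 \<le> (\<Sum>m\<in>I. \<Sum>n\<in>I. prob (A m \<inter> A n)) - 2 * t * s + t\<^sup>2 * q"
        unfolding s_def by (rule has_bochner_integral_nonneg)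
      with second have "0 \<le> 2 * C * s * (s + K) + s - 2 * t * s + t\<^sup>2 * q" by simp
      also have "\<dots> = s * ((1 + 2 * C * K) - s * (2 * C * (1 - 2 * C * q)))"
        by (simp add: t_def algebra_simps power2_eq_square)
      finally have "s = 0 \<or> s * (2 * C * (1 - 2 * C * q)) \<le> 1 + 2 * C * K"
        using s0 by (auto simp: zero_le_mult_iff)
      then show ?thesis
        unfolding s_def[symmetric] I_def[symmetric] b_def using q C
        by (auto simp: field_simps)
    qed
    have "sum p {..<N} \<le> sum p {..<K} + \<bar>b\<bar>" for N
    proof (cases "K \<le> N")
      case True
      then have "sum p {..<N} = sum p {..<K} + sum p {K..<N}"
        by (subst sum.union_disjoint[symmetric]) (auto intro!: sum.cong)
      then show ?thesis using tail[OF True] by linarith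
    next
      case False
      then have "sum p {..<N} \<le> sum p {..<K}" by (intro sum_mono2) (auto simp: p)
      then show ?thesis by simp
    qed
    then have "summable p" using p by (intro summableI_nonneg_bounded) auto
    with div show False by (simp add: p_def[abs_def])
  qed
  have "(\<lambda>K. prob (D K)) \<longlonglongrightarrow> prob (\<Inter>K. D K)"
    by (rule finite_Lim_measure_decseq) (auto 0 4 simp: decseq_def D_def Bex_def intro: order_trans)
  then have "1 / (2 * C) \<le> prob (\<Inter>K. D K)"
    by (rule LIMSEQ_le_const) (use D_ge in auto)
  moreover have "(\<Inter>K. D K) = {\<omega> \<in> space M. \<exists>\<^sub>\<infinity>n. \<omega> \<in> A n}"
    using sets.sets_into_space[OF A] by (fastforce simp: D_def INFM_nat_le)
  moreover have "0 < 1 / (2 * C)" using C by simp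
  ultimately show ?thesis by (metis less_le_trans)
qed

section \<open>Symmetric random walks\<close>

text \<open>Fubini: for each value \<open>x\<close> of \<open>U\<close> in \<open>B\<close> the
  event asks that \<open>V + x\<close> have absolute value below \<open>s\<close>, and
  \<open>c\<close> bounds this probability uniformly in \<open>x\<close>.\<close>

lemma (in prob_space) indep_small_sum_bound:
  fixes U V :: "'a \<Rightarrow> real"
  assumes UV: "indep_var borel U borel V" and B[measurable]: "B \<in> sets borel"
    and c: "\<And>y. prob {\<omega> \<in> space M. \<bar>V \<omega> + y\<bar> < s} \<le> c"
  shows "prob {\<omega> \<in> space M. U \<omega> \<in> B \<and> \<bar>U \<omega> + V \<omega>\<bar> < s} \<le> c * prob {\<omega> \<in> space M. U \<omega> \<in> B}"
proof -
  have [measurable]: "random_variable borel U" "random_variable borel V"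
    using UV by (auto dest: indep_var_rv1 indep_var_rv2)
  interpret V: prob_space "distr M borel V" by (rule prob_space_distr) simp
  have joint: "distr M borel U \<Otimes>\<^sub>M distr M borel V = distr M (borel \<Otimes>\<^sub>M borel) (\<lambda>x. (U x, V x))"
    using UV unfolding indep_var_distribution_eq by simp
  have c0: "0 \<le> c" using c[of 0] measure_nonneg order_trans by blast
  define E where "E = {x :: real \<times> real. fst x \<in> B \<and> \<bar>fst x + snd x\<bar> < s}"
  have E_eq: "E = {x \<in> space (borel \<Otimes>\<^sub>M borel). fst x \<in> B \<and> \<bar>fst x + snd x\<bar> < s}"
    by (simp add: E_def space_pair_measure)
  have E[measurable]: "E \<in> sets (borel \<Otimes>\<^sub>M borel)"
    unfolding E_eq by measurable
  have "(\<lambda>x. (U x, V x)) -` E \<inter> space M = {\<omega> \<in> space M. U \<omega> \<in> B \<and> \<bar>U \<omega> + V \<omega>\<bar> < s}"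
    by (auto simp: E_def)
  then have "ennreal (prob {\<omega> \<in> space M. U \<omega> \<in> B \<and> \<bar>U \<omega> + V \<omega>\<bar> < s})
      = emeasure (distr M (borel \<Otimes>\<^sub>M borel) (\<lambda>x. (U x, V x))) E"
    by (simp add: emeasure_distr emeasure_eq_measure)
  also have "\<dots> = (\<integral>\<^sup>+x. emeasure (distr M borel V) (Pair x -` E) \<partial>distr M borel U)"
    unfolding joint[symmetric] by (rule V.emeasure_pair_measure_alt) simp
  also have "\<dots> \<le> (\<integral>\<^sup>+x. ennreal c * indicator B x \<partial>distr M borel U)"
  proof (rule nn_integral_mono)
    fix x :: real
    have "emeasure (distr M borel V) (Pair x -` E) \<le> ennreal c" if "x \<in> B"
    proof -
      have "emeasure (distr M borel V) (Pair x -` E) = prob {\<omega> \<in> space M. \<bar>V \<omega> + x\<bar> < s}"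
        using that sets_Pair1[OF E, of x]
        by (subst emeasure_distr) (auto simp: E_def emeasure_eq_measure add.commute intro!: arg_cong[where f=prob])
      with c[of x] show ?thesis by (simp add: ennreal_leI)
    qed
    then show "emeasure (distr M borel V) (Pair x -` E) \<le> ennreal c * indicator B x"
      by (cases "x \<in> B") (auto simp: E_def)
  qed
  also have "\<dots> = ennreal c * emeasure M {\<omega> \<in> space M. U \<omega> \<in> B}"
    by (subst nn_integral_cmult_indicator) (auto simp: emeasure_distr vimage_def Int_def conj_commute)
  also have "\<dots> = ennreal (c * prob {\<omega> \<in> space M. U \<omega> \<in> B})"
    by (simp add: emeasure_eq_measure ennreal_mult[OF c0])
  finally show ?thesis using c0 by (simp add: ennreal_le_iff)
qed

section \<open>Reindexing and laws of i.i.d. sums\<close>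

lemma (in prob_space) indep_vars_inj_reindex:
  assumes "inj_on h I" "indep_vars M' X (h ` I)"
  shows "indep_vars (\<lambda>i. M' (h i)) (\<lambda>i. X (h i)) I"
  unfolding indep_vars_def2
proof (intro conjI ballI indep_setsI)
  fix A J assume J: "J \<noteq> {}" "J \<subseteq> I" "finite J"
    and A: "\<forall>j\<in>J. A j \<in> {X (h j) -` B \<inter> space M |B. B \<in> sets (M' (h j))}"
  have inj: "inj_on h J" using assms(1) J(2) by (rule inj_on_subset)
  let ?A = "\<lambda>k. A (the_inv_into J h k)"
  have "prob (\<Inter>k\<in>h ` J. ?A k) = (\<Prod>k\<in>h ` J. prob (?A k))"
    by (rule indep_setsD[of "\<lambda>k. {X k -` B \<inter> space M |B. B \<in> sets (M' k)}" "h ` I"])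
      (use assms(2) J A inj in \<open>auto simp: indep_vars_def2 the_inv_into_f_f\<close>)
  then show "prob (\<Inter>j\<in>J. A j) = (\<Prod>j\<in>J. prob (A j))"
    by (simp add: prod.reindex[OF inj] the_inv_into_f_f[OF inj] cong: INF_cong_simp prod.cong)
qed (use assms(2) in \<open>auto simp: indep_vars_def2\<close>)

text \<open>Naming the law of a sum of \<open>n\<close> steps without reference to the index set
  makes all blocks of equal length interchangeable.\<close>

primrec conv_power :: "real measure \<Rightarrow> nat \<Rightarrow> real measure" where
  "conv_power F 0 = return borel 0"
| "conv_power F (Suc n) = convolution F (conv_power F n)"

lemma (in prob_space) distr_sum_iid:
  fixes X :: "'i \<Rightarrow> 'a \<Rightarrow> real"
  assumes "finite I" "indep_vars (\<lambda>_. borel) X I" "\<And>i. i \<in> I \<Longrightarrow> distr M borel (X i) = F"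
  shows "distr M borel (\<lambda>\<omega>. \<Sum>i\<in>I. X i \<omega>) = conv_power F (card I)"
  using assms
proof (induction I rule: finite_induct)
  case empty
  then show ?case by (simp add: distr_const)
next
  case (insert i I)
  have [measurable]: "random_variable borel (X j)" if "j \<in> insert i I" for j
    using insert.prems(1) that unfolding indep_vars_def by blast
  have "distr M borel (\<lambda>\<omega>. X i \<omega> + (\<Sum>i\<in>I. X i \<omega>))
      = convolution (distr M borel (X i)) (distr M borel (\<lambda>\<omega>. \<Sum>i\<in>I. X i \<omega>))"
    by (rule sum_indep_random_variable[OF indep_vars_sum]) (use insert in \<open>auto intro!: borel_measurable_sum\<close>)
  moreover have "distr M borel (\<lambda>\<omega>. \<Sum>i\<in>I. X i \<omega>) = conv_power F (card I)"
    using insert.prems by (intro insert.IH) (auto intro: indep_vars_subset)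
  ultimately show ?case using insert by simp
qed

locale symmetric_random_walk = prob_space M for M :: "'a measure" +
  fixes Y :: "nat \<Rightarrow> 'a \<Rightarrow> real" and F :: "real measure"
  assumes indep: "indep_vars (\<lambda>_. borel) Y UNIV"
    and law: "\<And>i. distr M borel (Y i) = F"
    and symm: "distr F borel uminus = F"
begin

definition walk :: "nat \<Rightarrow> 'a \<Rightarrow> real" where
  "walk n \<omega> = (\<Sum>i<n. Y i \<omega>)"

lemma measurable_step[measurable]: "random_variable borel (Y i)"
  using indep by (simp add: indep_vars_def)

lemma measurable_walk[measurable]: "random_variable borel (walk n)"
  unfolding walk_def by measurable

lemma distr_block: "finite I \<Longrightarrow> distr M borel (\<lambda>\<omega>. \<Sum>i\<in>I. Y i \<omega>) = conv_power F (card I)"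
  by (rule distr_sum_iid) (auto intro: indep_vars_subset[OF indep] law)

text \<open>Symmetry of the steps enters here: the negated steps are again independent with law
  \<open>F\<close>.\<close>

lemma distr_minus_block: "finite I \<Longrightarrow> distr M borel (\<lambda>\<omega>. - (\<Sum>i\<in>I. Y i \<omega>)) = conv_power F (card I)"
proof -
  assume "finite I"
  have "distr M borel (\<lambda>\<omega>. - Y i \<omega>) = F" for i
    using distr_distr[of uminus borel borel "Y i" M] by (simp add: law symm comp_def)
  then have "distr M borel (\<lambda>\<omega>. \<Sum>i\<in>I. - Y i \<omega>) = conv_power F (card I)"
    using \<open>finite I\<close>
    by (intro distr_sum_iid indep_vars_subset[OF indep_vars_compose2[OF indep, of "\<lambda>_. uminus"]]) auto
  then show ?thesis by (simp add: sum_negf)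
qed

lemma distr_walk: "distr M borel (walk n) = conv_power F n"
  using distr_block[of "{..<n}"] by (simp add: walk_def[abs_def])

lemma indep_walk_increment:
  assumes "m \<le> n"
  shows "indep_var borel (walk m) borel (\<lambda>\<omega>. \<Sum>i\<in>{m..<n}. Y i \<omega>)"
proof -
  have "indep_var borel ((\<lambda>f. \<Sum>i\<in>{..<m}. f i) \<circ> (\<lambda>\<omega>. restrict (\<lambda>i. Y i \<omega>) {..<m}))
    borel ((\<lambda>f. \<Sum>i\<in>{m..<n}. f i) \<circ> (\<lambda>\<omega>. restrict (\<lambda>i. Y i \<omega>) {m..<n}))"
    by (intro indep_var_compose[OF indep_var_restrict[OF indep]]) auto
  then show ?thesis by (simp add: comp_def walk_def[abs_def])
qed

lemma walk_add: "m \<le> n \<Longrightarrow> walk n \<omega> = walk m \<omega> + (\<Sum>i\<in>{m..<n}. Y i \<omega>)"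
  unfolding walk_def by (subst sum.union_disjoint[symmetric]) (auto intro!: sum.cong)

lemma prob_increment:
  assumes "m \<le> n"
  shows "prob {\<omega> \<in> space M. \<bar>(\<Sum>i\<in>{m..<n}. Y i \<omega>) + y\<bar> < s} = prob {\<omega> \<in> space M. \<bar>walk (n - m) \<omega> + y\<bar> < s}"
proof -
  have eq: "prob {\<omega> \<in> space M. \<bar>V \<omega> + y\<bar> < s} = measure (distr M borel V) {x. \<bar>x + y\<bar> < s}"
    if [measurable]: "random_variable borel V" for V
    by (subst measure_distr) (auto intro!: arg_cong[where f=prob])
  show ?thesis
    by (subst (1 2) eq) (use distr_block[of "{m..<n}"] in \<open>auto simp: distr_walk\<close>)
qed

section \<open>Concentration and renewal estimates for the walk\<close>

lemma concentration_even:
  assumes "e > 0"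
  shows "prob {\<omega> \<in> space M. \<bar>walk (2 * n) \<omega> + y\<bar> < real K * e}
    \<le> (2 * real K + 2) * prob {\<omega> \<in> space M. \<bar>walk (2 * n) \<omega>\<bar> < e}"
proof -
  \<comment> \<open>\<open>V\<close> is minus the second half of the steps: it is independent of
    \<open>walk n\<close>, has the same law by symmetry, and satisfies
    \<open>walk n - V = walk (2 * n)\<close>.\<close>
  define V where "V \<omega> = - (\<Sum>i\<in>{n..<2 * n}. Y i \<omega>)" for \<omega>
  have [measurable]: "random_variable borel V" unfolding V_def by measurable
  have "indep_var borel (id \<circ> walk n) borel (uminus \<circ> (\<lambda>\<omega>. \<Sum>i\<in>{n..<2 * n}. Y i \<omega>))"
    by (rule indep_var_compose[OF indep_walk_increment]) auto
  then have "indep_var borel (walk n) borel V" by (simp add: V_def[abs_def] comp_def)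
  moreover have "distr M borel V = conv_power F n"
    using distr_minus_block[of "{n..<2 * n}"] by (simp add: V_def[abs_def])
  ultimately have joint: "conv_power F n \<Otimes>\<^sub>M conv_power F n = distr M (borel \<Otimes>\<^sub>M borel) (\<lambda>\<omega>. (walk n \<omega>, V \<omega>))"
    unfolding indep_var_distribution_eq by (simp add: distr_walk)
  have diff: "walk n \<omega> - V \<omega> = walk (2 * n) \<omega>" for \<omega>
    using walk_add[of n "2 * n"] by (simp add: V_def)
  have "measure (conv_power F n \<Otimes>\<^sub>M conv_power F n) {x. \<bar>fst x - snd x + z\<bar> < s}
      = prob {\<omega> \<in> space M. \<bar>walk (2 * n) \<omega> + z\<bar> < s}" for z s
  proof -
    have "{x :: real \<times> real. \<bar>fst x - snd x + z\<bar> < s} \<in> sets (borel \<Otimes>\<^sub>M borel)"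
      using measurable_sets[of "\<lambda>x::real\<times>real. \<bar>fst x - snd x + z\<bar>" "borel \<Otimes>\<^sub>M borel" borel "{..<s}"]
      by (simp add: vimage_def space_pair_measure)
    then show ?thesis
      unfolding joint by (subst measure_distr) (auto simp: diff intro!: arg_cong[where f=prob])
  qed
  note this[of y "real K * e"] this[of 0 e]
  moreover have "prob_space (conv_power F n)" "sets (conv_power F n) = sets borel"
    by (auto simp flip: distr_walk intro: prob_space_distr)
  ultimately show ?thesis
    using concentration_difference[of "conv_power F n" e y K] assms by simp
qed

text \<open>An odd time reduces to the even time before it by conditioning on the first step, since
  the bound at even times is uniform in the shift.\<close>

lemma concentration:
  assumes "e > 0"
  shows "prob {\<omega> \<in> space M. \<bar>walk n \<omega> + y\<bar> < real K * e}
    \<le> (2 * real K + 2) * prob {\<omega> \<in> space M. \<bar>walk (2 * (n div 2)) \<omega>\<bar> < e}"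
proof -
  \<comment> \<open>\<open>m\<close> is the parity of \<open>n\<close>, the number of steps to split
    off.\<close>
  define m where "m = n - 2 * (n div 2)"
  have m: "m \<le> n" "n - m = 2 * (n div 2)" by (auto simp: m_def)
  have "prob {\<omega> \<in> space M. walk m \<omega> \<in> UNIV \<and> \<bar>walk m \<omega> + ((\<Sum>i\<in>{m..<n}. Y i \<omega>) + y)\<bar> < real K * e}
    \<le> ((2 * real K + 2) * prob {\<omega> \<in> space M. \<bar>walk (2 * (n div 2)) \<omega>\<bar> < e}) * prob {\<omega> \<in> space M. walk m \<omega> \<in> UNIV}"
  proof (rule indep_small_sum_bound)
    show "indep_var borel (walk m) borel (\<lambda>\<omega>. (\<Sum>i\<in>{m..<n}. Y i \<omega>) + y)"
      using indep_var_compose[OF indep_walk_increment[OF m(1)], of id borel "\<lambda>x. x + y" borel]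
      by (simp add: comp_def)
    fix z
    show "prob {\<omega> \<in> space M. \<bar>(\<Sum>i\<in>{m..<n}. Y i \<omega>) + y + z\<bar> < real K * e}
      \<le> (2 * real K + 2) * prob {\<omega> \<in> space M. \<bar>walk (2 * (n div 2)) \<omega>\<bar> < e}"
      using prob_increment[OF m(1), of "y + z"] concentration_even[OF assms, of "n div 2" "y + z" K]
      by (simp add: m(2) add.assoc)
  qed simp
  then show ?thesis using walk_add[OF m(1)] by (simp add: prob_space add.assoc)
qed

text \<open>Given \<open>walk (2 * m)\<close>, the event at time \<open>2 * n\<close> confines an
  independent increment of \<open>2 * (n - m)\<close> steps to an interval of radius
  \<open>r (2 * n)\<close>. Concentration with \<open>K = 1\<close> recentres it at 0 at the cost of
  the factor 4, and \<open>r\<close> being decreasing enlarges the radius to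
  \<open>r (2 * (n - m))\<close>.\<close>

lemma small_walk_renewal:
  fixes r :: "nat \<Rightarrow> real"
  assumes r: "\<And>n. r n > 0" "antimono r" and "m < n"
  defines "A \<equiv> \<lambda>n. {\<omega> \<in> space M. \<bar>walk (2 * n) \<omega>\<bar> < r (2 * n)}"
  shows "prob (A m \<inter> A n) \<le> 4 * prob (A m) * prob (A (n - m))"
proof -
  let ?V = "\<lambda>\<omega>. \<Sum>i\<in>{2 * m..<2 * n}. Y i \<omega>"
  have [measurable]: "A k \<in> events" for k unfolding A_def by measurable
  have bound: "prob {\<omega> \<in> space M. \<bar>?V \<omega> + y\<bar> < r (2 * n)} \<le> 4 * prob (A (n - m))" for y
  proof -
    have "r (2 * n) \<le> r (2 * (n - m))" using antimonoD[OF r(2)] by simp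
    then have "prob {\<omega> \<in> space M. \<bar>walk (2 * (n - m)) \<omega>\<bar> < r (2 * n)} \<le> prob (A (n - m))"
      by (intro finite_measure_mono) (auto simp: A_def)
    then show ?thesis
      using prob_increment[of "2 * m" "2 * n" y "r (2 * n)"] concentration_even[OF r(1), of "n - m" y 1 "2 * n"] assms(3)
      by (simp flip: diff_mult_distrib2)
  qed
  have "prob {\<omega> \<in> space M. walk (2 * m) \<omega> \<in> {- r (2 * m)<..<r (2 * m)} \<and> \<bar>walk (2 * m) \<omega> + ?V \<omega>\<bar> < r (2 * n)}
      \<le> 4 * prob (A (n - m)) * prob {\<omega> \<in> space M. walk (2 * m) \<omega> \<in> {- r (2 * m)<..<r (2 * m)}}"
    by (rule indep_small_sum_bound[OF indep_walk_increment _ bound]) (use assms(3) in auto)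
  moreover have "{\<omega> \<in> space M. walk (2 * m) \<omega> \<in> {- r (2 * m)<..<r (2 * m)}} = A m"
    by (auto simp: A_def)
  moreover have "{\<omega> \<in> space M. walk (2 * m) \<omega> \<in> {- r (2 * m)<..<r (2 * m)} \<and> \<bar>walk (2 * m) \<omega> + ?V \<omega>\<bar> < r (2 * n)} = A m \<inter> A n"
    using walk_add[of "2 * m" "2 * n"] assms(3) by (auto simp: A_def)
  ultimately show ?thesis by (simp add: mult_ac)
qed

text \<open>The Kochen-Stone lemma only gives positive probability. The event is then viewed on the
  space of step sequences, where finite permutations act and the zero-one law applies.\<close>

lemma AE_frequently_small:
  fixes r :: "nat \<Rightarrow> real"
  assumes r: "\<And>n. r n > 0" "antimono r"
    and div: "\<not> summable (\<lambda>n. prob {\<omega> \<in> space M. \<bar>walk (2 * n) \<omega>\<bar> < r (2 * n)})"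
  shows "AE \<omega> in M. \<exists>\<^sub>\<infinity>n. \<bar>walk (2 * n) \<omega>\<bar> < r (2 * n)"
proof -
  define A where "A n = {\<omega> \<in> space M. \<bar>walk (2 * n) \<omega>\<bar> < r (2 * n)}" for n
  have [measurable]: "A n \<in> events" for n unfolding A_def by measurable
  have pos: "prob {\<omega> \<in> space M. \<exists>\<^sub>\<infinity>n. \<omega> \<in> A n} > 0"
    by (rule kochen_stone_renewal[of A 4]) (use small_walk_renewal[OF r] div in \<open>auto simp: A_def\<close>)
  define N where "N = PiM UNIV (\<lambda>_::nat. F)"
  have F: "prob_space F" using prob_space_distr[of "Y 0" borel] by (simp add: law)
  have setsF: "sets F = sets borel" by (simp flip: law[of 0])
  have [measurable_cong]: "sets N = sets (PiM UNIV (\<lambda>_. borel))"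
    unfolding N_def by (rule sets_PiM_cong) (simp_all add: setsF)
  have spN: "space N = UNIV"
    using sets_eq_imp_space_eq[OF setsF] by (simp add: N_def space_PiM)
  have Y[measurable]: "(\<lambda>\<omega> i. Y i \<omega>) \<in> measurable M N"
    unfolding N_def by (rule measurable_PiM_single') (auto simp: measurable_cong_sets[OF refl setsF] sets_eq_imp_space_eq[OF setsF])
  have "distr M (PiM UNIV (\<lambda>_. borel)) (\<lambda>\<omega>. \<lambda>i\<in>UNIV. Y i \<omega>) = N"
    using indep unfolding N_def by (subst (asm) indep_vars_iff_distr_eq_PiM') (auto simp: law)
  then have distr: "distr M N (\<lambda>\<omega> i. Y i \<omega>) = N"
    using distr_cong[of M M N "PiM UNIV (\<lambda>_. borel)" "\<lambda>\<omega> i. Y i \<omega>" "\<lambda>\<omega> i. Y i \<omega>"]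
    by (simp add: restrict_def \<open>sets N = _\<close>)
  define H where "H = {y :: nat \<Rightarrow> real. \<exists>\<^sub>\<infinity>n. \<bar>\<Sum>i<2 * n. y i\<bar> < r (2 * n)}"
  have "{y \<in> space N. \<exists>\<^sub>\<infinity>n. \<bar>\<Sum>i<2 * n. y i\<bar> < r (2 * n)} \<in> sets N"
    unfolding INFM_nat_le by measurable
  then have H[measurable]: "H \<in> sets N" by (simp add: H_def spN)
  have "measure N H = 0 \<or> measure N H = 1"
    unfolding N_def
  proof (rule hewitt_savage_zero_one[OF F H[unfolded N_def]])
    fix \<pi> :: "nat \<Rightarrow> nat" and y :: "nat \<Rightarrow> real"
    assume \<pi>: "bij \<pi>" "finite {i. \<pi> i \<noteq> i}" and "y \<in> H"
    obtain k where k: "{i. \<pi> i \<noteq> i} \<subseteq> {..<k}" using \<pi>(2) finite_nat_bounded by blast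
    \<comment> \<open>A permutation moving only coordinates below \<open>k\<close> leaves every sum
      of the first \<open>2 * n\<close> terms with \<open>n \<ge> k\<close> unchanged, and
      membership in \<open>H\<close> depends only on large \<open>n\<close>.\<close>
    have "(\<Sum>i<2 * n. (y \<circ> \<pi>) i) = (\<Sum>i<2 * n. y i)" if "k \<le> n" for n
    proof -
      have "\<pi> permutes {..<2 * n}"
        using \<pi>(1) k that by (auto simp: permutes_def bij_iff subset_iff)
      then show ?thesis using sum.permute[of \<pi> "{..<2 * n}" y] by simp
    qed
    then have "eventually (\<lambda>n. \<bar>\<Sum>i<2 * n. y i\<bar> < r (2 * n) \<longrightarrow> \<bar>\<Sum>i<2 * n. (y \<circ> \<pi>) i\<bar> < r (2 * n)) sequentially"
      unfolding eventually_sequentially by (intro exI[of _ k]) auto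
    then show "y \<circ> \<pi> \<in> H"
      using \<open>y \<in> H\<close> frequently_mp by (auto simp: H_def cofinite_eq_sequentially)
  qed
  moreover have "(\<lambda>\<omega> i. Y i \<omega>) -` H \<inter> space M = {\<omega> \<in> space M. \<exists>\<^sub>\<infinity>n. \<bar>walk (2 * n) \<omega>\<bar> < r (2 * n)}"
    by (auto simp: H_def walk_def)
  then have "measure N H = prob {\<omega> \<in> space M. \<exists>\<^sub>\<infinity>n. \<bar>walk (2 * n) \<omega>\<bar> < r (2 * n)}"
    using measure_distr[OF Y H] by (simp add: distr)
  moreover have "{\<omega> \<in> space M. \<exists>\<^sub>\<infinity>n. \<bar>walk (2 * n) \<omega>\<bar> < r (2 * n)} = {\<omega> \<in> space M. \<exists>\<^sub>\<infinity>n. \<omega> \<in> A n}"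
    by (auto simp: A_def)
  ultimately have "prob {\<omega> \<in> space M. \<exists>\<^sub>\<infinity>n. \<bar>walk (2 * n) \<omega>\<bar> < r (2 * n)} = 1"
    using pos by auto
  then show ?thesis
    by (subst (asm) prob_Collect_eq_1) (auto simp: INFM_nat_le)
qed

text \<open>Convergence along even times at one scale forces it along all times at every multiple of
  that scale. Read contrapositively, it carries divergence to smaller scales.\<close>

lemma summable_small_walk:
  fixes r :: "nat \<Rightarrow> real"
  assumes r: "\<And>n. r n > 0" "antimono r"
    and s: "summable (\<lambda>n. prob {\<omega> \<in> space M. \<bar>walk (2 * n) \<omega>\<bar> < r (2 * n)})"
  shows "summable (\<lambda>n. prob {\<omega> \<in> space M. \<bar>walk n \<omega>\<bar> < real K * r n})"
proof -
  define q where "q n = prob {\<omega> \<in> space M. \<bar>walk (2 * n) \<omega>\<bar> < r (2 * n)}" for n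
  have q: "summable q" using s by (simp add: q_def[abs_def])
  \<comment> \<open>Each \<open>q i\<close> is counted exactly twice, at the times
    \<open>2 * i\<close> and \<open>2 * i + 1\<close>.\<close>
  have "summable (\<lambda>n. q (n div 2))"
  proof (rule summableI_nonneg_bounded)
    fix n
    have "(\<Sum>i<2 * m. q (i div 2)) = 2 * (\<Sum>i<m. q i)" for m by (induction m) auto
    then have "(\<Sum>i<2 * n. q (i div 2)) \<le> 2 * suminf q"
      using sum_le_suminf[OF q, of "{..<n}"] by (simp add: q_def)
    moreover have "(\<Sum>i<n. q (i div 2)) \<le> (\<Sum>i<2 * n. q (i div 2))"
      by (rule sum_mono2) (auto simp: q_def)
    ultimately show "(\<Sum>i<n. q (i div 2)) \<le> 2 * suminf q" by simp
  qed (simp add: q_def)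
  then have "summable (\<lambda>n. (2 * real K + 2) * q (n div 2))" by (rule summable_mult)
  then show ?thesis
  proof (rule summable_comparison_test'[where N = 0])
    fix n
    have "prob {\<omega> \<in> space M. \<bar>walk n \<omega>\<bar> < real K * r n}
        \<le> (2 * real K + 2) * prob {\<omega> \<in> space M. \<bar>walk (2 * (n div 2)) \<omega>\<bar> < r n}"
      using concentration[OF r(1)[of n], of n 0 K] by simp
    also have "\<dots> \<le> (2 * real K + 2) * q (n div 2)"
      unfolding q_def using antimonoD[OF r(2), of "2 * (n div 2)" n]
      by (intro mult_left_mono finite_measure_mono) auto
    finally show "norm (prob {\<omega> \<in> space M. \<bar>walk n \<omega>\<bar> < real K * r n}) \<le> (2 * real K + 2) * q (n div 2)"
      by simp
  qed
qed

end

section \<open>The dichotomy\<close>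

lemma symmetric_distribution_uminus:
  assumes "symmetric_distribution F"
  shows "distr F borel uminus = F"
proof -
  obtain Q :: "real measure" and Z where Z: "symmetric_rv Q Z" "F = distr Q borel Z"
    using assms unfolding symmetric_distribution_def by blast
  then have "distr F borel uminus = distr Q borel (\<lambda>\<omega>. - Z \<omega>)"
    by (simp add: distr_distr symmetric_rv_def comp_def)
  with Z show ?thesis by (simp add: symmetric_rv_def)
qed

theorem theorem1:
  fixes P :: "'a measure" and F :: "real measure"
    and X :: "nat \<Rightarrow> 'a \<Rightarrow> real" and g :: "nat \<Rightarrow> real" and M :: real
  assumes "prob_space P"
    and "prob_space.indep_vars P (\<lambda>_. borel) X {1..}"
    and "\<And>i. i \<ge> 1 \<Longrightarrow> distr P borel (X i) = F"
    and "symmetric_distribution F"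
    and "\<And>n. n \<ge> 1 \<Longrightarrow> g n > 0"
    and "mono_on {1..} g"
    and "M > 0"
  shows "((\<Sum>n. emeasure P {\<omega> \<in> space P. g (Suc n) * \<bar>partial_sum X (Suc n) \<omega>\<bar> < M}) = \<infinity> \<longrightarrow>
            (AE \<omega> in P. liminf (\<lambda>n. ereal (g n * \<bar>partial_sum X n \<omega>\<bar>)) = 0)) \<and>
         ((\<Sum>n. emeasure P {\<omega> \<in> space P. g (Suc n) * \<bar>partial_sum X (Suc n) \<omega>\<bar> < M}) \<noteq> \<infinity> \<longrightarrow>
            (AE \<omega> in P. liminf (\<lambda>n. ereal (g n * \<bar>partial_sum X n \<omega>\<bar>)) = \<infinity>))"
proof -
  interpret prob_space P by fact
  have "range Suc = {1..}" by (auto simp: image_def Suc_le_eq gr0_conv_Suc)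
  then have "indep_vars (\<lambda>_. borel) (\<lambda>i. X (Suc i)) UNIV"
    using indep_vars_inj_reindex[of Suc UNIV "\<lambda>_. borel" X] assms(2) by simp
  \<comment> \<open>Steps are renumbered from 0, so that \<open>walk n\<close> still has
    \<open>n\<close> summands.\<close>
  then interpret symmetric_random_walk P "\<lambda>i. X (Suc i)" F
    by unfold_locales (use assms(3) symmetric_distribution_uminus[OF assms(4)] in auto)
  have S: "partial_sum X n = walk n" for n
    unfolding partial_sum_def walk_def fun_eq_iff
    using sum.atLeast1_atMost_eq[of "\<lambda>i. X i _" n] by simp
  \<comment> \<open>\<open>g\<close> is controlled only from index 1 on. Replacing index 0 by 1
    keeps the radii positive and decreasing on all of \<open>nat\<close>.\<close>
  define r where "r e n = e / g (max 1 n)" for e and n :: nat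
  have r: "r e n > 0" "antimono (r e)" if "e > 0" for e n
    using that assms(5) mono_onD[OF assms(6)]
    by (auto simp: r_def antimono_def intro!: divide_left_mono)
  have small_iff: "g n * \<bar>x\<bar> < K * e \<longleftrightarrow> \<bar>x\<bar> < K * r e n" if "n \<ge> 1" for n x e K
    using assms(5)[OF that] that by (simp add: r_def max_def field_simps)
  define p where "p e n = prob {\<omega> \<in> space P. \<bar>walk n \<omega>\<bar> < r e n}" for e n
  have summable_iff: "summable (p M) \<longleftrightarrow>
      (\<Sum>n. emeasure P {\<omega> \<in> space P. g (Suc n) * \<bar>partial_sum X (Suc n) \<omega>\<bar> < M}) \<noteq> \<infinity>"
  proof -
    have "(\<Sum>n. emeasure P {\<omega> \<in> space P. g (Suc n) * \<bar>partial_sum X (Suc n) \<omega>\<bar> < M})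
        = (\<Sum>n. ennreal (p M (Suc n)))"
      using small_iff[of "Suc _" _ 1 M] by (simp add: p_def S emeasure_eq_measure)
    \<comment> \<open>The series in the statement starts at time 1, while \<open>p M\<close> also
      has a term at time 0.\<close>
    moreover have "summable (p M) \<longleftrightarrow> summable (\<lambda>n. p M (Suc n))"
      by (simp add: summable_Suc_iff)
    moreover have "\<dots> \<longleftrightarrow> (\<Sum>n. ennreal (p M (Suc n))) \<noteq> \<infinity>"
    proof
      have p0: "0 \<le> p M (Suc n)" for n by (simp add: p_def)
      show "(\<Sum>n. ennreal (p M (Suc n))) \<noteq> \<infinity>" if "summable (\<lambda>n. p M (Suc n))"
        by (simp only: suminf_ennreal2[OF p0 that] infinity_ennreal_def ennreal_neq_top not_False_eq_True)
      show "summable (\<lambda>n. p M (Suc n))" if "(\<Sum>n. ennreal (p M (Suc n))) \<noteq> \<infinity>"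
        using that unfolding infinity_ennreal_def by (intro summable_suminf_not_top p0)
    qed
    ultimately show ?thesis by simp
  qed
  have transfer: "summable (\<lambda>n. prob {\<omega> \<in> space P. \<bar>walk n \<omega>\<bar> < real K * r e n})"
    if "e > 0" "summable (\<lambda>n. p e (2 * n))" for e K
    using summable_small_walk[OF r[OF that(1)]] that(2) by (simp add: p_def)
  show ?thesis
  proof (intro conjI impI)
    assume "(\<Sum>n. emeasure P {\<omega> \<in> space P. g (Suc n) * \<bar>partial_sum X (Suc n) \<omega>\<bar> < M}) = \<infinity>"
    then have div: "\<not> summable (p M)" using summable_iff by simp
    have "AE \<omega> in P. \<exists>\<^sub>\<infinity>n. \<bar>walk (2 * n) \<omega>\<bar> < r (inverse (real (Suc k))) (2 * n)" for k
    proof (rule AE_frequently_small)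
      define e where "e = inverse (real (Suc k))"
      show "r (inverse (real (Suc k))) n > 0" "antimono (r (inverse (real (Suc k))))" for n
        using r by auto
      \<comment> \<open>With \<open>K * e\<close> above \<open>M\<close>, convergence at scale
        \<open>e\<close> would transfer to scale \<open>M\<close>, against the assumed
        divergence.\<close>
      obtain K :: nat where K: "M < real K * e"
        using reals_Archimedean3[of e] by (auto simp: e_def)
      show "\<not> summable (\<lambda>n. prob {\<omega> \<in> space P. \<bar>walk (2 * n) \<omega>\<bar> < r (inverse (real (Suc k))) (2 * n)})"
      proof
        assume "summable (\<lambda>n. prob {\<omega> \<in> space P. \<bar>walk (2 * n) \<omega>\<bar> < r (inverse (real (Suc k))) (2 * n)})"
        then have "summable (\<lambda>n. prob {\<omega> \<in> space P. \<bar>walk n \<omega>\<bar> < real K * r e n})"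
          by (intro transfer) (auto simp: e_def p_def)
        then have "summable (p M)"
        proof (rule summable_comparison_test'[where N = 0])
          fix n
          have "r M n \<le> real K * r e n"
            using K assms(5)[of "max 1 n"] by (simp add: r_def divide_right_mono)
          then show "norm (p M n) \<le> prob {\<omega> \<in> space P. \<bar>walk n \<omega>\<bar> < real K * r e n}"
            unfolding p_def by (auto intro!: finite_measure_mono)
        qed
        with div show False by simp
      qed
    qed
    \<comment> \<open>Countably many scales tending to 0 suffice to pin the lower limit, so a single
      null set serves for all of them.\<close>
    then have "AE \<omega> in P. \<forall>k. \<exists>\<^sub>\<infinity>n. \<bar>walk (2 * n) \<omega>\<bar> < r (inverse (real (Suc k))) (2 * n)"
      by (simp add: AE_all_countable)
    then show "AE \<omega> in P. liminf (\<lambda>n. ereal (g n * \<bar>partial_sum X n \<omega>\<bar>)) = 0"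
    proof eventually_elim
      case (elim \<omega>)
      let ?L = "liminf (\<lambda>n. ereal (g n * \<bar>partial_sum X n \<omega>\<bar>))"
      have "?L \<le> ereal (inverse (real (Suc k)))" for k
      proof (rule ccontr)
        assume "\<not> ?thesis"
        then have "eventually (\<lambda>n. ereal (inverse (real (Suc k))) < ereal (g n * \<bar>partial_sum X n \<omega>\<bar>)) sequentially"
          by (intro less_LiminfD) (simp add: not_le)
        then obtain n0 where n0: "\<And>n. n \<ge> n0 \<Longrightarrow> inverse (real (Suc k)) < g n * \<bar>walk n \<omega>\<bar>"
          by (auto simp: eventually_sequentially S)
        \<comment> \<open>Taking \<open>n\<close> above \<open>n0\<close> gives both
          \<open>2 * n \<ge> n0\<close> and \<open>2 * n \<ge> 1\<close>, the latter for
          \<open>small_iff\<close>.\<close>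
        obtain n where n: "n \<ge> Suc n0" "\<bar>walk (2 * n) \<omega>\<bar> < r (inverse (real (Suc k))) (2 * n)"
          using elim[rule_format, of k] unfolding INFM_nat_le by blast
        then show False
          using small_iff[of "2 * n" "walk (2 * n) \<omega>" 1 "inverse (real (Suc k))"] n0[of "2 * n"] by simp
      qed
      moreover have "(\<lambda>k. ereal (inverse (real (Suc k)))) \<longlonglongrightarrow> ereal 0"
        using LIMSEQ_inverse_real_of_nat by simp
      ultimately have "?L \<le> ereal 0"
        by (intro LIMSEQ_le_const[of "\<lambda>k. ereal (inverse (real (Suc k)))"]) auto
      \<comment> \<open>The sign of \<open>g 0\<close> is unspecified, so nonnegativity is claimed
        from index 1 on.\<close>
      moreover have "eventually (\<lambda>n. 0 \<le> ereal (g n * \<bar>partial_sum X n \<omega>\<bar>)) sequentially"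
        using eventually_ge_at_top[of 1] by eventually_elim (simp add: assms(5) less_imp_le)
      then have "0 \<le> ?L" by (rule Liminf_bounded)
      ultimately show ?case by (simp add: antisym zero_ereal_def)
    qed
  next
    assume "(\<Sum>n. emeasure P {\<omega> \<in> space P. g (Suc n) * \<bar>partial_sum X (Suc n) \<omega>\<bar> < M}) \<noteq> \<infinity>"
    then have "summable (p M)" using summable_iff by simp
    \<comment> \<open>The even subseries is what \<open>transfer\<close> takes as input; its output
      covers every multiple \<open>K\<close> of the radius, hence Borel-Cantelli applies at all
      levels \<open>K * M\<close>.\<close>
    then have "summable (\<lambda>n. p M (2 * n))"
      using summable_reindex[of "p M" "\<lambda>n. 2 * n"] by (simp add: comp_def inj_def p_def)
    then have "AE \<omega> in P. eventually (\<lambda>n. \<omega> \<in> space P - {\<omega> \<in> space P. \<bar>walk n \<omega>\<bar> < real K * r M n}) sequentially" for K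
      using transfer[OF \<open>M > 0\<close>, of K] by (intro borel_cantelli_AE1) (auto simp: emeasure_eq_measure)
    then have "AE \<omega> in P. \<forall>K. eventually (\<lambda>n. \<omega> \<in> space P - {\<omega> \<in> space P. \<bar>walk n \<omega>\<bar> < real K * r M n}) sequentially"
      unfolding AE_all_countable by blast
    then show "AE \<omega> in P. liminf (\<lambda>n. ereal (g n * \<bar>partial_sum X n \<omega>\<bar>)) = \<infinity>"
    proof eventually_elim
      case (elim \<omega>)
      let ?L = "liminf (\<lambda>n. ereal (g n * \<bar>partial_sum X n \<omega>\<bar>))"
      have "ereal (real K * M) \<le> ?L" for K
      proof (rule Liminf_bounded)
        show "eventually (\<lambda>n. ereal (real K * M) \<le> ereal (g n * \<bar>partial_sum X n \<omega>\<bar>)) sequentially"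
          using elim[rule_format, of K] eventually_ge_at_top[of 1]
        proof eventually_elim
          case (elim n)
          then have "\<not> \<bar>walk n \<omega>\<bar> < real K * r M n" by simp
          then have "\<not> g n * \<bar>walk n \<omega>\<bar> < real K * M" using small_iff elim by blast
          then show ?case by (simp add: S)
        qed
      qed
      \<comment> \<open>The levels \<open>K * M\<close> are unbounded because
        \<open>M > 0\<close>.\<close>
      then have "ereal B \<le> ?L" for B
        using reals_Archimedean3[OF \<open>M > 0\<close>] by (meson ereal_less_eq(3) less_imp_le order_trans)
      then show ?case by (simp add: ereal_top)
    qed
  qed
qed

end
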